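(* Let $1<q<+\infty$ and let $L\colon[a,b]\times\mathbb{R}^{n}\times\mathbb{R}^n\to\mathbb{R}^d$, $(t,y,p)\mapsto L(t,y,p)$, be of class $C^1$ with $|L_i(t,y,p)|\le K_1(|y|^q+|p|^q+1)$ for some constant $K_1$, every component $L_i$ and all $t\in[a,b]$, $y,p\in\mathbb{R}^n$. Let $B_0$ be a base of $C^+$ and assume that there exist $\alpha>0$, $\beta\ge0$ such that $$\zeta\cdot L(t,y,p)\ge\alpha|p|^q-\beta\qquad\text{for all }\zeta\in B_0,\ t\in[a,b],\ y,p\in\mathbb{R}^n,$$ and that $\overline L(t,y,p)=L(t,y,p)+C$ is convex in $(y,p)$. Then the set $$M=\{y_\zeta\in\mathcal{X}_1\mid\zeta\in B_0\},$$ where for each $\zeta\in B_0$ the arc $y_\zeta$ is a $\zeta$-solution, is a $C^+$-solution of the problem $\inf_{y\in\mathcal{X}_1}\overline J(y)$.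
   Context: Let $a<b$ be real, $n\ge 1$, $d>1$ integers, $A,B\in\mathbb{R}^n$, and let $\emptyset\neq C\subsetneq\mathbb{R}^d$ be a closed convex cone with dual $C^+=\{\zeta\in\mathbb{R}^d\mid \zeta\cdot z\ge 0\ \forall z\in C\}$. A base of $C^+$ is a set $B_0\subseteq C^+\setminus\{0\}$ such that for each $\zeta\in C^+\setminus\{0\}$ there are unique $\zeta_0\in B_0$ and $s>0$ with $\zeta=s\zeta_0$. Let $\mathcal{G}(\mathbb{R}^d,C)=\{D\subseteq\mathbb{R}^d\mid D=\mathrm{cl\,co}(D+C)\}$, ordered by $\supseteq$; the infimum of a family is the closed convex hull of its union. Put $\mathcal{X}_1=\{y\in W^{1,q}([a,b];\mathbb{R}^n)\mid y(a)=A,\ y(b)=B\}$ (using continuous representatives), $J(y)=\int_a^bL(t,y(t),\dot y(t))\,dt\in\mathbb{R}^d$, $\overline J\colon\mathcal{X}_1\to\mathcal{G}(\mathbb{R}^d,C)$, $\overline J(y)=J(y)+C$, $J_\zeta(y)=\zeta\cdot J(y)$. Convexity of $\overline L$ in $(y,p)$ means that for all $t\in[a,b]$, $(y_1,p_1),(y_2,p_2)$ and $\lambda\in(0,1)$, $\overline L(t,\lambda y_1+(1-\lambda)y_2,\lambda p_1+(1-\lambda)p_2)\supseteq\lambda\overline L(t,y_1,p_1)+(1-\lambda)\overline L(t,y_2,p_2)$. For $\zeta\in C^+\setminus\{0\}$, a $\zeta$-solution is an arc $y_\zeta\in\mathcal{X}_1$ with $J_\zeta(y_\zeta)=\inf_{y\in\mathcal{X}_1}J_\zeta(y)$;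 under the hypotheses of the claim at least one $\zeta$-solution exists for every $\zeta\in C^+\setminus\{0\}$ by the classical direct method (Tonelli), so that $M$ can be formed by choosing one for each $\zeta\in B_0$. A set $M\subseteq\mathcal{X}_1$ is an infimizer if $\mathrm{cl\,co}\bigcup_{y\in M}\overline J(y)=\mathrm{cl\,co}\bigcup_{y\in\mathcal{X}_1}\overline J(y)$; an infimizer all of whose elements are $\zeta$-solutions for some $\zeta\in C^+\setminus\{0\}$ is called a $C^+$-solution. *)

theory Defs
  imports "HOL-Analysis.Analysis"
begin

section \<open>Cones and set-valued infima\<close>

definition dual_cone :: "'v::real_inner set \<Rightarrow> 'v set" where
  "dual_cone C = {\<zeta>. \<forall>z\<in>C. 0 \<le> \<zeta> \<bullet> z}"

definition is_cone_base :: "'v::real_vector set \<Rightarrow> 'v set \<Rightarrow> bool" where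
  "is_cone_base B0 K \<longleftrightarrow>
     B0 \<subseteq> K - {0} \<and>
     (\<forall>\<zeta>\<in>K - {0}. \<exists>!(\<zeta>0, s). \<zeta>0 \<in> B0 \<and> (0::real) < s \<and> \<zeta> = s *\<^sub>R \<zeta>0)"

text \<open>The infimum of a family of closed convex upper sets D = cl co (D + C) with respect to
  the order \<open>\<supseteq>\<close>.\<close>

definition set_inf :: "'v::real_normed_vector set set \<Rightarrow> 'v set" where
  "set_inf \<D> = closure (convex hull (\<Union>\<D>))"

definition is_infimizer :: "('x \<Rightarrow> 'v::real_normed_vector set) \<Rightarrow> 'x set \<Rightarrow> 'x set \<Rightarrow> bool" where
  "is_infimizer F X M \<longleftrightarrow> M \<subseteq> X \<and> set_inf (F ` M) = set_inf (F ` X)"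

text \<open>The infimum is taken in the extended reals, since \<open>Inf\<close> on type \<^typ>\<open>real\<close> is
  unspecified for sets that are not bounded below.\<close>

definition is_zeta_solution :: "('x \<Rightarrow> 'v::real_inner) \<Rightarrow> 'x set \<Rightarrow> 'v \<Rightarrow> 'x \<Rightarrow> bool" where
  "is_zeta_solution J X \<zeta> y \<longleftrightarrow>
     y \<in> X \<and> ereal (\<zeta> \<bullet> J y) = (INF x\<in>X. ereal (\<zeta> \<bullet> J x))"

definition is_dual_cone_solution ::
    "('x \<Rightarrow> 'v::real_inner) \<Rightarrow> 'v set \<Rightarrow> 'x set \<Rightarrow> 'x set \<Rightarrow> bool" where
  "is_dual_cone_solution J C X M \<longleftrightarrow>
     is_infimizer (\<lambda>y. J y +o C) X M \<and>
     (\<forall>y\<in>M. \<exists>\<zeta>\<in>dual_cone C - {0}. is_zeta_solution J X \<zeta> y)"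


section \<open>Sobolev arcs on a compact interval\<close>

definition test_fun :: "real \<Rightarrow> real \<Rightarrow> (real \<Rightarrow> real) \<Rightarrow> bool" where
  "test_fun a b \<phi> \<longleftrightarrow>
     (\<forall>k t. ((deriv ^^ k) \<phi>) field_differentiable (at t)) \<and>
     closure {t. \<phi> t \<noteq> 0} \<subseteq> {a<..<b}"

definition loc_integrable :: "real \<Rightarrow> real \<Rightarrow> (real \<Rightarrow> 'v::euclidean_space) \<Rightarrow> bool" where
  "loc_integrable a b f \<longleftrightarrow>
     (\<forall>c d. a < c \<longrightarrow> c \<le> d \<longrightarrow> d < b \<longrightarrow> set_integrable lebesgue {c..d} f)"

definition has_weak_deriv ::
    "real \<Rightarrow> real \<Rightarrow> (real \<Rightarrow> 'v::euclidean_space) \<Rightarrow> (real \<Rightarrow> 'v) \<Rightarrow> bool" where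
  "has_weak_deriv a b y v \<longleftrightarrow>
     loc_integrable a b y \<and> loc_integrable a b v \<and>
     (\<forall>\<phi>. test_fun a b \<phi> \<longrightarrow>
        (LINT t:{a..b}|lebesgue. deriv \<phi> t *\<^sub>R y t) =
        - (LINT t:{a..b}|lebesgue. \<phi> t *\<^sub>R v t))"

definition in_Lq :: "real \<Rightarrow> real \<Rightarrow> real \<Rightarrow> (real \<Rightarrow> 'v::euclidean_space) \<Rightarrow> bool" where
  "in_Lq a b q f \<longleftrightarrow>
     set_borel_measurable lebesgue {a..b} f \<and>
     set_integrable lebesgue {a..b} (\<lambda>t. norm (f t) powr q)"

definition in_W1q :: "real \<Rightarrow> real \<Rightarrow> real \<Rightarrow> (real \<Rightarrow> 'v::euclidean_space) \<Rightarrow> bool" where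
  "in_W1q a b q y \<longleftrightarrow> in_Lq a b q y \<and> (\<exists>v. has_weak_deriv a b y v \<and> in_Lq a b q v)"

text \<open>Weak derivatives are unique up to null sets, so an integral over \<open>{a..b}\<close> that involves
  the following representative does not depend on the choice.\<close>

definition weak_deriv :: "real \<Rightarrow> real \<Rightarrow> (real \<Rightarrow> 'v::euclidean_space) \<Rightarrow> real \<Rightarrow> 'v" where
  "weak_deriv a b y = (SOME v. has_weak_deriv a b y v)"

text \<open>Arcs are total functions whose values outside \<open>{a..b}\<close> are irrelevant: membership in the
  following set and the functional below depend only on the restriction to \<open>{a..b}\<close>.\<close>

definition admissible_arcs ::
    "real \<Rightarrow> real \<Rightarrow> real \<Rightarrow> 'v::euclidean_space \<Rightarrow> 'v \<Rightarrow> (real \<Rightarrow> 'v) set" where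
  "admissible_arcs a b q A B =
     {y. continuous_on {a..b} y \<and> in_W1q a b q y \<and> y a = A \<and> y b = B}"


section \<open>The variational problem\<close>

definition action ::
    "real \<Rightarrow> real \<Rightarrow> (real \<Rightarrow> 'v::euclidean_space \<Rightarrow> 'v \<Rightarrow> 'w::euclidean_space)
      \<Rightarrow> (real \<Rightarrow> 'v) \<Rightarrow> 'w" where
  "action a b L y = (LINT t:{a..b}|lebesgue. L t (y t) (weak_deriv a b y t))"

text \<open>For a set such as \<open>{a..b} \<times> UNIV\<close> the derivative at boundary points is the one-sided one
  (taken within the set); it is unique if the set is convex with nonempty interior.\<close>

definition C1_on :: "'u::real_normed_vector set \<Rightarrow> ('u \<Rightarrow> 'w::real_normed_vector) \<Rightarrow> bool" where
  "C1_on S f \<longleftrightarrow>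
     (\<exists>f' :: 'u \<Rightarrow> 'u \<Rightarrow>\<^sub>L 'w.
        (\<forall>x\<in>S. (f has_derivative blinfun_apply (f' x)) (at x within S)) \<and>
        continuous_on S f')"

definition set_valued_convex ::
    "'u::real_vector set \<Rightarrow> ('u \<Rightarrow> 'w::real_vector set) \<Rightarrow> bool" where
  "set_valued_convex X F \<longleftrightarrow>
     (\<forall>x1\<in>X. \<forall>x2\<in>X. \<forall>l. 0 < l \<and> l < 1 \<longrightarrow>
        ((*\<^sub>R) l ` F x1) + ((*\<^sub>R) (1 - l) ` F x2) \<subseteq> F (l *\<^sub>R x1 + (1 - l) *\<^sub>R x2))"

end

theory Submission
  imports Defs
begin

text \<open>A hyperplane that strictly separates a point from a nonempty closed convex set \<open>D = D + C\<close> has its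
  normal in \<open>C\<^sup>+ - {0}\<close>. If \<open>D\<close> is generated by the values of the scalarised minimisers and the point by
  an arbitrary arc, the normal, rescaled into the base, contradicts minimality.\<close>

text \<open>A cone is stable under scaling by large factors, so a single negative value of the
  functional would produce arbitrarily negative ones and violate any lower bound.\<close>

lemma dual_coneI_bounded_below:
  fixes \<zeta> :: "'v::real_inner"
  assumes "cone C" and lower: "\<And>z. z \<in> C \<Longrightarrow> r < \<zeta> \<bullet> z"
  shows "\<zeta> \<in> dual_cone C"
  unfolding dual_cone_def
proof (intro CollectI ballI leI notI)
  fix z assume z: "z \<in> C" and neg: "\<zeta> \<bullet> z < 0"
  \<comment> \<open>With this factor the functional takes the value \<open>- \<bar>r\<bar>\<close>
    at \<open>k *\<^sub>R z\<close>, which is at most \<open>r\<close>.\<close>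
  define k where "k = \<bar>r\<bar> / - (\<zeta> \<bullet> z)"
  have "0 \<le> k"
    using neg unfolding k_def by (intro divide_nonneg_pos) auto
  with \<open>cone C\<close> z have "k *\<^sub>R z \<in> C"
    by (simp add: mem_cone)
  then have "r < \<zeta> \<bullet> (k *\<^sub>R z)"
    by (rule lower)
  also have "\<dots> = - \<bar>r\<bar>"
    using neg by (simp add: k_def)
  finally show False
    by linarith
qed

text \<open>Separating \<open>C\<close> from a point outside it yields a nonzero element of the dual
  cone, which must have a representative in the base. This ensures later that the set generated by
  the minimisers is nonempty; separation from an empty set would say nothing about the
  normal.\<close>

lemma cone_base_nonempty:
  fixes C :: "'v::euclidean_space set"
  assumes "C \<noteq> {}" "C \<noteq> UNIV" "closed C" "convex C" "cone C"
    and base: "is_cone_base B0 (dual_cone C)"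
  shows "B0 \<noteq> {}"
proof -
  from \<open>C \<noteq> UNIV\<close> obtain z where "z \<notin> C"
    by blast
  with \<open>closed C\<close> \<open>convex C\<close> obtain \<zeta> r where r: "\<zeta> \<bullet> z < r" "\<And>x. x \<in> C \<Longrightarrow> r < \<zeta> \<bullet> x"
    using separating_hyperplane_closed_point by metis
  then have "\<zeta> \<in> dual_cone C"
    using \<open>cone C\<close> dual_coneI_bounded_below by blast
  moreover have "\<zeta> \<noteq> 0"
    using r \<open>C \<noteq> {}\<close> by fastforce
  ultimately show ?thesis
    using base unfolding is_cone_base_def by blast
qed

lemma cone_base_scaled:
  assumes "is_cone_base B0 K" "\<zeta> \<in> K" "\<zeta> \<noteq> 0"
  obtains \<zeta>0 s where "\<zeta>0 \<in> B0" "0 < s" "\<zeta> = s *\<^sub>R \<zeta>0"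
proof -
  from assms have "\<exists>!(\<zeta>0, s). \<zeta>0 \<in> B0 \<and> 0 < s \<and> \<zeta> = s *\<^sub>R \<zeta>0"
    unfolding is_cone_base_def by blast
  with that show thesis
    by (auto dest!: ex1_implies_ex)
qed

lemma zeta_solution_le:
  assumes "is_zeta_solution J X \<zeta> y" "x \<in> X"
  shows "\<zeta> \<bullet> J y \<le> \<zeta> \<bullet> J x"
proof -
  have "ereal (\<zeta> \<bullet> J y) \<le> ereal (\<zeta> \<bullet> J x)"
    using assms unfolding is_zeta_solution_def by (metis INF_lower)
  then show ?thesis
    by simp
qed

text \<open>The separation takes place in the image space, hence the abstract \<open>J\<close> and
  \<open>X\<close>; minimality enters only through comparison of scalarised values.\<close>

theorem dual_cone_solution_of_base:
  fixes C :: "'v::euclidean_space set"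
  assumes C: "C \<noteq> {}" "C \<noteq> UNIV" "closed C" "convex C" "cone C"
    and base: "is_cone_base B0 (dual_cone C)"
    and sol: "\<And>\<zeta>. \<zeta> \<in> B0 \<Longrightarrow> is_zeta_solution J X \<zeta> (Y \<zeta>)"
  shows "is_dual_cone_solution J C X (Y ` B0)"
proof -
  let ?F = "\<lambda>y. J y +o C"
  let ?D = "set_inf (?F ` Y ` B0)"
  have YX: "Y ` B0 \<subseteq> X"
    using sol by (auto simp: is_zeta_solution_def)
  have D: "closed ?D" "convex ?D"
    by (simp_all add: set_inf_def convex_closure)
  have F_D: "?F (Y \<zeta>) \<subseteq> ?D" if "\<zeta> \<in> B0" for \<zeta>
  proof -
    have "?F (Y \<zeta>) \<subseteq> \<Union> (?F ` Y ` B0)"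
      using that by blast
    also have "\<dots> \<subseteq> convex hull \<dots>"
      by (rule hull_subset)
    also have "\<dots> \<subseteq> ?D"
      unfolding set_inf_def by (rule closure_subset)
    finally show ?thesis .
  qed
  have "J x + c \<in> ?D" if x: "x \<in> X" and c: "c \<in> C" for x c
  proof (rule ccontr)
    assume "J x + c \<notin> ?D"
    with D obtain \<zeta> r where r: "\<zeta> \<bullet> (J x + c) < r" "\<And>w. w \<in> ?D \<Longrightarrow> r < \<zeta> \<bullet> w"
      using separating_hyperplane_closed_point by metis
    have above: "r < \<zeta> \<bullet> (J (Y \<eta>) + z)" if "\<eta> \<in> B0" "z \<in> C" for \<eta> z
      using r(2) F_D that by (blast intro: set_plus_intro2)
    \<comment> \<open>One fixed translate of \<open>C\<close> inside \<open>?D\<close> suffices to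
      bound the normal below on \<open>C\<close>.\<close>
    obtain \<eta> where \<eta>: "\<eta> \<in> B0"
      using cone_base_nonempty[OF C base] by blast
    have "r - \<zeta> \<bullet> J (Y \<eta>) < \<zeta> \<bullet> z" if "z \<in> C" for z
      using above[OF \<eta> that] by (simp add: inner_add_right)
    then have dual: "\<zeta> \<in> dual_cone C"
      using \<open>cone C\<close> dual_coneI_bounded_below by blast
    \<comment> \<open>A zero normal would force both \<open>0 < r\<close> and
      \<open>r < 0\<close>.\<close>
    moreover have "\<zeta> \<noteq> 0"
      using r(1) above[OF \<eta> c] by auto
    ultimately obtain \<zeta>0 s where s: "\<zeta>0 \<in> B0" "0 < s" "\<zeta> = s *\<^sub>R \<zeta>0"
      using base cone_base_scaled by blast
    have "0 \<in> C"
      using C by (simp add: cone_contains_0)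
    then have "r < \<zeta> \<bullet> J (Y \<zeta>0)"
      using above[OF s(1)] by force
    \<comment> \<open>\<open>Y \<zeta>0\<close> minimises for \<open>\<zeta>0\<close>, and the
      positive factor \<open>s\<close> carries the inequality over to
      \<open>\<zeta>\<close>.\<close>
    also have "\<dots> \<le> \<zeta> \<bullet> J x"
      using zeta_solution_le[OF sol[OF s(1)] x] s by simp
    also have "\<dots> \<le> \<zeta> \<bullet> (J x + c)"
      using dual c by (simp add: dual_cone_def inner_add_right)
    finally show False
      using r(1) by simp
  qed
  then have "\<Union> (?F ` X) \<subseteq> ?D"
    by (auto simp: elt_set_plus_def)
  then have "set_inf (?F ` X) \<subseteq> ?D"
    using D unfolding set_inf_def[of "?F ` X"] by (intro closure_minimal hull_minimal)
  \<comment> \<open>This inclusion is monotonicity of the closed convex hull; separation was needed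
    only for the other one.\<close>
  moreover have "?D \<subseteq> set_inf (?F ` X)"
    unfolding set_inf_def using YX by (intro closure_mono hull_mono) blast
  ultimately have "is_infimizer ?F X (Y ` B0)"
    using YX by (simp add: is_infimizer_def)
  moreover have "\<exists>\<zeta>\<in>dual_cone C - {0}. is_zeta_solution J X \<zeta> y" if "y \<in> Y ` B0" for y
    using that sol base unfolding is_cone_base_def by blast
  ultimately show ?thesis
    by (simp add: is_dual_cone_solution_def)
qed

theorem theorem4p3:
  fixes a b q K1 \<alpha> \<beta> :: real
    and A B :: "real ^ 'n"
    and C B0 :: "(real ^ 'd) set"
    and L :: "real \<Rightarrow> real ^ 'n \<Rightarrow> real ^ 'n \<Rightarrow> real ^ 'd"
    and Y :: "real ^ 'd \<Rightarrow> real \<Rightarrow> real ^ 'n"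
  assumes "a < b"
    and "1 < CARD('d)"
    and "C \<noteq> {}" "C \<noteq> UNIV" "closed C" "convex C" "cone C"
    and "1 < q"
    and "C1_on ({a..b} \<times> UNIV \<times> UNIV) (\<lambda>(t, y, p). L t y p)"
    and "\<And>i t y p. t \<in> {a..b} \<Longrightarrow> \<bar>L t y p $ i\<bar> \<le> K1 * (norm y powr q + norm p powr q + 1)"
    and "is_cone_base B0 (dual_cone C)"
    and "0 < \<alpha>" "0 \<le> \<beta>"
    and "\<And>\<zeta> t y p. \<zeta> \<in> B0 \<Longrightarrow> t \<in> {a..b} \<Longrightarrow> \<alpha> * norm p powr q - \<beta> \<le> \<zeta> \<bullet> L t y p"
    and "\<And>t. t \<in> {a..b} \<Longrightarrow> set_valued_convex UNIV (\<lambda>(y, p). L t y p +o C)"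
    and "\<And>\<zeta>. \<zeta> \<in> B0 \<Longrightarrow> is_zeta_solution (action a b L) (admissible_arcs a b q A B) \<zeta> (Y \<zeta>)"
  shows "is_dual_cone_solution (action a b L) C (admissible_arcs a b q A B) (Y ` B0)"
  \<comment> \<open>The minimisers are supplied by \<open>Y\<close>, so the abstract result applies
    with \<open>J\<close> the action and \<open>X\<close> the admissible arcs.\<close>
  using assms by (intro dual_cone_solution_of_base)

end
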